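(* Let $E=L^1(\mathbb{R})\cap C_0(\mathbb{R})$ (complex-valued functions) with norm $\|f\|_E=\max\{\|f\|_1,\|f\|_\infty\}$. Let $\varphi(f)=\int_{\mathbb{R}}f(x)\,dx$ for $f\in E$, fix $f_0\in E$ with $0<f_0(x)\le 1$ for all $x\in\mathbb{R}$ and $\int_{\mathbb{R}}f_0(x)\,dx=1$, and put $F=\operatorname{span}(f_0)$ and $G=\ker\varphi$, so that $E=F\oplus G$. Let $(T_t)_{t\ge 0}$ be the $C_0$-semigroup on $E$ defined by $$(T_tf)(x)=\varphi(f)f_0(x)+\big[f(x+t)-\varphi(f)f_0(x+t)\big],\qquad t\ge 0,\ x\in\mathbb{R},\ f\in E.$$ Then the generator $A$ of $(T_t)_{t\ge 0}$ is $$A=0_{|F}\oplus B_{|G},\qquad D(A)=F\oplus D(B_{|G}),$$ where $B_{|G}$ is the generator of the left translation semigroup on $G$, and is given by $B_{|G}f=\frac{df}{dx}$ with $$D(B_{|G})=\Big\{f\in G:\ \frac{df}{dx}\in G\Big\}.$$ Moreover, $\sigma(A)=i\mathbb{R}$, and $0$ is an eigenvalue of $A$ with a one-dimensional eigenspace spanned by the positive function $f_0$.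
   Context: The left translation semigroup $(S_t)_{t\ge0}$ is $(S_tf)(x)=f(x+t)$; it leaves $G$ invariant. The decomposition $E=F\oplus G$ is the one induced by the rank-one projection $Pf=\varphi(f)f_0$, with $F=\operatorname{rg}P$ and $G=\ker P$; the semigroup $(T_t)$ acts as the identity on $F$ and as left translation on $G$. $C_0(\mathbb{R})$ denotes the continuous functions on $\mathbb{R}$ vanishing at infinity. *)

theory Defs
  imports "HOL-Analysis.Analysis" "HOL-Library.Function_Algebras" "HOL-Library.Set_Algebras"
begin

section \<open>Complex-valued functions as a complex vector space\<close>

definition scaleC :: "complex \<Rightarrow> ('a \<Rightarrow> complex) \<Rightarrow> 'a \<Rightarrow> complex"  (infixr \<open>*\<^sub>C\<close> 75)
  where "c *\<^sub>C f = (\<lambda>x. c * f x)"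

interpretation cfun: vector_space "scaleC :: complex \<Rightarrow> ('a \<Rightarrow> complex) \<Rightarrow> 'a \<Rightarrow> complex"
  by unfold_locales (auto simp: scaleC_def fun_eq_iff algebra_simps)

definition direct_sum :: "('a \<Rightarrow> complex) set \<Rightarrow> ('a \<Rightarrow> complex) set \<Rightarrow> ('a \<Rightarrow> complex) set \<Rightarrow> bool"
  where "direct_sum X U V \<longleftrightarrow>
    cfun.subspace X \<and> cfun.subspace U \<and> cfun.subspace V \<and> X = U + V \<and> U \<inter> V = {0}"


section \<open>Semigroups, generators and spectra\<close>

text \<open>
  A normed space of functions is given by its carrier \<open>X\<close> and its norm \<open>N\<close>, which is only
  meaningful on \<open>X\<close>. An unbounded operator is given by its domain \<open>D\<close> and by a function \<open>A\<close>
  whose values outside \<open>D\<close> are irrelevant.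
\<close>

definition C0_semigroup ::
  "('a \<Rightarrow> complex) set \<Rightarrow> (('a \<Rightarrow> complex) \<Rightarrow> real) \<Rightarrow>
   (real \<Rightarrow> ('a \<Rightarrow> complex) \<Rightarrow> ('a \<Rightarrow> complex)) \<Rightarrow> bool"
  where "C0_semigroup X N T \<longleftrightarrow>
    cfun.subspace X \<and>
    (\<forall>t\<ge>0. (\<forall>f\<in>X. T t f \<in> X) \<and>
           (\<forall>f\<in>X. \<forall>g\<in>X. T t (f + g) = T t f + T t g) \<and>
           (\<forall>c. \<forall>f\<in>X. T t (c *\<^sub>C f) = c *\<^sub>C T t f) \<and>
           (\<exists>C. \<forall>f\<in>X. N (T t f) \<le> C * N f)) \<and>
    (\<forall>f\<in>X. T 0 f = f) \<and>
    (\<forall>s\<ge>0. \<forall>t\<ge>0. \<forall>f\<in>X. T (s + t) f = T s (T t f)) \<and>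
    (\<forall>f\<in>X. \<forall>s\<ge>0. ((\<lambda>t. N (T t f - T s f)) \<longlongrightarrow> 0) (at s within {0..}))"

definition has_generator_value ::
  "(('a \<Rightarrow> complex) \<Rightarrow> real) \<Rightarrow> (real \<Rightarrow> ('a \<Rightarrow> complex) \<Rightarrow> ('a \<Rightarrow> complex)) \<Rightarrow>
   ('a \<Rightarrow> complex) \<Rightarrow> ('a \<Rightarrow> complex) \<Rightarrow> bool"
  where "has_generator_value N T f g \<longleftrightarrow>
    ((\<lambda>t. N (complex_of_real (1 / t) *\<^sub>C (T t f - f) - g)) \<longlongrightarrow> 0) (at_right 0)"

definition generator_domain ::
  "('a \<Rightarrow> complex) set \<Rightarrow> (('a \<Rightarrow> complex) \<Rightarrow> real) \<Rightarrow>
   (real \<Rightarrow> ('a \<Rightarrow> complex) \<Rightarrow> ('a \<Rightarrow> complex)) \<Rightarrow> ('a \<Rightarrow> complex) set"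
  where "generator_domain X N T = {f \<in> X. \<exists>g\<in>X. has_generator_value N T f g}"

definition generator ::
  "('a \<Rightarrow> complex) set \<Rightarrow> (('a \<Rightarrow> complex) \<Rightarrow> real) \<Rightarrow>
   (real \<Rightarrow> ('a \<Rightarrow> complex) \<Rightarrow> ('a \<Rightarrow> complex)) \<Rightarrow> ('a \<Rightarrow> complex) \<Rightarrow> ('a \<Rightarrow> complex)"
  where "generator X N T f = (THE g. g \<in> X \<and> has_generator_value N T f g)"

definition operator_direct_sum ::
  "('a \<Rightarrow> complex) set \<Rightarrow> (('a \<Rightarrow> complex) \<Rightarrow> ('a \<Rightarrow> complex)) \<Rightarrow>
   ('a \<Rightarrow> complex) set \<Rightarrow> (('a \<Rightarrow> complex) \<Rightarrow> ('a \<Rightarrow> complex)) \<Rightarrow>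
   ('a \<Rightarrow> complex) set \<Rightarrow> (('a \<Rightarrow> complex) \<Rightarrow> ('a \<Rightarrow> complex)) \<Rightarrow> bool"
  where "operator_direct_sum D A D1 A1 D2 A2 \<longleftrightarrow>
    direct_sum D D1 D2 \<and> (\<forall>u\<in>D1. \<forall>v\<in>D2. A (u + v) = A1 u + A2 v)"

definition resolvent_set ::
  "('a \<Rightarrow> complex) set \<Rightarrow> (('a \<Rightarrow> complex) \<Rightarrow> real) \<Rightarrow>
   ('a \<Rightarrow> complex) set \<Rightarrow> (('a \<Rightarrow> complex) \<Rightarrow> ('a \<Rightarrow> complex)) \<Rightarrow> complex set"
  where "resolvent_set X N D A =
    {z. bij_betw (\<lambda>f. z *\<^sub>C f - A f) D X \<and> (\<exists>C. \<forall>f\<in>D. N f \<le> C * N (z *\<^sub>C f - A f))}"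

definition spectrum ::
  "('a \<Rightarrow> complex) set \<Rightarrow> (('a \<Rightarrow> complex) \<Rightarrow> real) \<Rightarrow>
   ('a \<Rightarrow> complex) set \<Rightarrow> (('a \<Rightarrow> complex) \<Rightarrow> ('a \<Rightarrow> complex)) \<Rightarrow> complex set"
  where "spectrum X N D A = - resolvent_set X N D A"

definition eigenspace ::
  "('a \<Rightarrow> complex) set \<Rightarrow> (('a \<Rightarrow> complex) \<Rightarrow> ('a \<Rightarrow> complex)) \<Rightarrow> complex \<Rightarrow>
   ('a \<Rightarrow> complex) set"
  where "eigenspace D A z = {f \<in> D. A f = z *\<^sub>C f}"

definition eigenvalue ::
  "('a \<Rightarrow> complex) set \<Rightarrow> (('a \<Rightarrow> complex) \<Rightarrow> ('a \<Rightarrow> complex)) \<Rightarrow> complex \<Rightarrow> bool"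
  where "eigenvalue D A z \<longleftrightarrow> (\<exists>f\<in>D. f \<noteq> 0 \<and> A f = z *\<^sub>C f)"


section \<open>The concrete spaces and semigroups\<close>

definition spaceE :: "(real \<Rightarrow> complex) set"
  where "spaceE =
    {f. integrable lborel f \<and> continuous_on UNIV f \<and> (f \<longlongrightarrow> 0) at_infinity}"

definition normE :: "(real \<Rightarrow> complex) \<Rightarrow> real"
  where "normE f = max (LINT x|lborel. norm (f x)) (SUP x. norm (f x))"

definition phi :: "(real \<Rightarrow> complex) \<Rightarrow> complex"
  where "phi f = (LINT x|lborel. f x)"

definition spaceF :: "(real \<Rightarrow> complex) \<Rightarrow> (real \<Rightarrow> complex) set"
  where "spaceF f0 = cfun.span {f0}"

definition spaceG :: "(real \<Rightarrow> complex) set"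
  where "spaceG = {f \<in> spaceE. phi f = 0}"

definition left_translation :: "real \<Rightarrow> (real \<Rightarrow> complex) \<Rightarrow> (real \<Rightarrow> complex)"
  where "left_translation t f = (\<lambda>x. f (x + t))"

definition semigroupT ::
  "(real \<Rightarrow> complex) \<Rightarrow> real \<Rightarrow> (real \<Rightarrow> complex) \<Rightarrow> (real \<Rightarrow> complex)"
  where "semigroupT f0 t f = (\<lambda>x. phi f * f0 x + (f (x + t) - phi f * f0 (x + t)))"

definition domA :: "(real \<Rightarrow> complex) \<Rightarrow> (real \<Rightarrow> complex) set"
  where "domA f0 = generator_domain spaceE normE (semigroupT f0)"

definition opA :: "(real \<Rightarrow> complex) \<Rightarrow> (real \<Rightarrow> complex) \<Rightarrow> (real \<Rightarrow> complex)"
  where "opA f0 = generator spaceE normE (semigroupT f0)"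

definition domB :: "(real \<Rightarrow> complex) set"
  where "domB = generator_domain spaceG normE left_translation"

definition opB :: "(real \<Rightarrow> complex) \<Rightarrow> (real \<Rightarrow> complex)"
  where "opB = generator spaceG normE left_translation"

text \<open>The classical derivative \<open>df/dx\<close>; it is only used for functions differentiable everywhere.\<close>

definition ddx :: "(real \<Rightarrow> complex) \<Rightarrow> (real \<Rightarrow> complex)"
  where "ddx f = (\<lambda>x. vector_derivative f (at x))"

end

theory Submission
  imports Defs
begin

text \<open>
  Every \<open>f \<in> E\<close> is uniquely \<open>c f\<^sub>0 + v\<close> with \<open>v \<in> G\<close>, and \<open>T\<^sub>t (c f\<^sub>0 + v) = c f\<^sub>0 + S\<^sub>t v\<close>, so everything
  reduces to translation. If \<open>f' = g\<close>, then \<open>(f(x + t) - f x) / t\<close> is the average of \<open>g\<close> over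
  \<open>[x, x + t]\<close>: it converges uniformly because \<open>g\<close> is uniformly continuous, and in \<open>L\<^sup>1\<close> by Scheffe's
  lemma, because averaging does not increase the \<open>L\<^sup>1\<close> norm. For \<open>Re z \<noteq> 0\<close> the equation
  \<open>z v - v' = g\<close> is solved by a Laplace transform, and no nonzero multiple of \<open>exp (z x)\<close> vanishes at
  infinity. For \<open>z \<in> i\<real>\<close>, \<open>z \<noteq> 0\<close>, surjectivity of \<open>z - A\<close> fails: its values in \<open>G\<close> have
  vanishing Fourier coefficient at \<open>z\<close>, and not all elements of \<open>G\<close> do.
\<close>

section \<open>The space E: linear structure, translation, reflection and the integral
  functional\<close>

lemma spaceE_D:
  assumes "f \<in> spaceE"
  shows "integrable lborel f" "continuous_on UNIV f" "(f \<longlongrightarrow> 0) at_infinity" "f \<in> borel_measurable borel"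
  using assms by (auto simp: spaceE_def intro: borel_measurable_continuous_onI)

lemma subspace_spaceE: "cfun.subspace spaceE"
proof (rule cfun.subspaceI)
  show "0 \<in> spaceE" by (simp add: spaceE_def zero_fun_def)
  show "f + g \<in> spaceE" if "f \<in> spaceE" "g \<in> spaceE" for f g
    using that by (auto simp: spaceE_def plus_fun_def intro!: continuous_intros tendsto_add_zero)
  show "c *\<^sub>C f \<in> spaceE" if "f \<in> spaceE" for c f
    using that by (auto simp: spaceE_def scaleC_def intro!: continuous_intros tendsto_mult_right_zero)
qed

lemmas spaceE_add = cfun.subspace_add[OF subspace_spaceE]
  and spaceE_diff = cfun.subspace_diff[OF subspace_spaceE]
  and spaceE_scaleC = cfun.subspace_scale[OF subspace_spaceE]

lemma phi_add: "f \<in> spaceE \<Longrightarrow> g \<in> spaceE \<Longrightarrow> phi (f + g) = phi f + phi g"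
  by (simp add: phi_def plus_fun_def spaceE_D)

lemma phi_diff: "f \<in> spaceE \<Longrightarrow> g \<in> spaceE \<Longrightarrow> phi (f - g) = phi f - phi g"
  by (simp add: phi_def fun_diff_def spaceE_D)

lemma phi_scaleC: "phi (c *\<^sub>C f) = c * phi f"
  by (simp add: phi_def scaleC_def)

lemma subspace_spaceG: "cfun.subspace spaceG"
proof (rule cfun.subspaceI)
  show "0 \<in> spaceG"
    using cfun.subspace_0[OF subspace_spaceE] by (simp add: spaceG_def phi_def zero_fun_def)
qed (auto simp: spaceG_def phi_add phi_scaleC spaceE_add spaceE_scaleC)

text \<open>Covers negative \<open>t\<close> as well: the spectral argument shifts by
  \<open>pi / Im z\<close>, whose sign is that of \<open>Im z\<close>.\<close>

lemma spaceE_left_translation: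
  assumes "f \<in> spaceE"
  shows "left_translation t f \<in> spaceE"
proof -
  have "filterlim (\<lambda>x::real. x + t) at_infinity at_infinity"
    by (rule tendsto_add_filterlim_at_infinity'[OF filterlim_ident tendsto_const])
  then have "((\<lambda>x. f (x + t)) \<longlongrightarrow> 0) at_infinity"
    using spaceE_D(3)[OF assms] by (rule filterlim_compose[rotated])
  moreover have "continuous_on UNIV (\<lambda>x. f (x + t))"
    by (rule continuous_on_compose2[OF spaceE_D(2)[OF assms]]) (auto intro!: continuous_intros)
  moreover have "integrable lborel (\<lambda>x. f (x + t))"
    using lborel_integrable_real_affine[OF spaceE_D(1)[OF assms], of 1 t] by (simp add: add.commute)
  ultimately show ?thesis
    by (simp add: spaceE_def left_translation_def)
qed

lemma phi_left_translation: "phi (left_translation t f) = phi f"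
  using lborel_integral_real_affine[of 1 f t] by (simp add: phi_def left_translation_def add.commute)

text \<open>Reflection carries the resolvent construction from the right half-plane to the left
  one.\<close>

lemma spaceE_reflect:
  assumes "f \<in> spaceE"
  shows "(\<lambda>x. f (- x)) \<in> spaceE"
proof -
  have "filterlim (\<lambda>x::real. - x) at_infinity at_infinity"
    by (rule filterlim_norm_at_top_imp_at_infinity, unfold norm_minus_cancel, rule filterlim_norm_at_top)
  then have "((\<lambda>x. f (- x)) \<longlongrightarrow> 0) at_infinity"
    using spaceE_D(3)[OF assms] by (rule filterlim_compose[rotated])
  moreover have "continuous_on UNIV (\<lambda>x. f (- x))"
    by (rule continuous_on_compose2[OF spaceE_D(2)[OF assms]]) (auto intro!: continuous_intros)
  moreover have "integrable lborel (\<lambda>x. f (- x))"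
    using lborel_integrable_real_affine[OF spaceE_D(1)[OF assms], of "-1" 0] by simp
  ultimately show ?thesis
    by (simp add: spaceE_def)
qed

section \<open>The norm of E\<close>

lemma spaceE_bounded:
  assumes "f \<in> spaceE"
  shows "bounded (range f)"
proof -
  obtain b where b: "\<And>x. b \<le> \<bar>x\<bar> \<Longrightarrow> norm (f x) < 1"
    using tendstoD[OF spaceE_D(3)[OF assms], of 1] by (auto simp: eventually_at_infinity)
  have "compact (f ` {-b..b})"
    by (intro compact_continuous_image continuous_on_subset[OF spaceE_D(2)[OF assms]]) auto
  then obtain B where B: "\<And>x. x \<in> {-b..b} \<Longrightarrow> norm (f x) \<le> B"
    by (force dest: compact_imp_bounded simp: bounded_iff)
  have "norm (f x) \<le> max B 1" for x
    using b[of x] B[of x] by (cases "b \<le> \<bar>x\<bar>") (auto simp: abs_if split: if_splits)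
  then show ?thesis
    by (auto simp: bounded_iff)
qed

text \<open>A real \<open>SUP\<close> is known to be an upper bound only over a set that is bounded
  above; \<open>spaceE_bounded\<close> provides this.\<close>

lemma norm_le_normE: "f \<in> spaceE \<Longrightarrow> norm (f x) \<le> normE f"
  unfolding normE_def using spaceE_bounded[of f]
  by (intro max.coboundedI2 cSUP_upper) (auto simp: bounded_iff bdd_above_def)

lemma L1_le_normE: "(LINT x|lborel. norm (f x)) \<le> normE f"
  by (simp add: normE_def)

lemma normE_le:
  assumes "(LINT x|lborel. norm (f x)) \<le> C" "\<And>x. norm (f x) \<le> C"
  shows "normE f \<le> C"
  unfolding normE_def using assms by (auto intro!: cSUP_least)

lemma normE_nonneg: "0 \<le> normE f"
  by (rule order_trans[OF _ L1_le_normE]) simp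

lemma normE_add:
  assumes "f \<in> spaceE" "g \<in> spaceE"
  shows "normE (f + g) \<le> normE f + normE g"
proof (rule normE_le)
  have "(LINT x|lborel. norm ((f + g) x)) \<le> (LINT x|lborel. norm (f x) + norm (g x))"
    using assms by (intro integral_mono) (auto simp: spaceE_D plus_fun_def norm_triangle_ineq)
  also have "\<dots> \<le> normE f + normE g"
    using assms by (subst Bochner_Integration.integral_add) (auto simp: spaceE_D intro!: add_mono L1_le_normE)
  finally show "(LINT x|lborel. norm ((f + g) x)) \<le> normE f + normE g" .
  show "norm ((f + g) x) \<le> normE f + normE g" for x
    using norm_triangle_ineq[of "f x" "g x"] norm_le_normE[OF assms(1), of x] norm_le_normE[OF assms(2), of x]
    by simp
qed

lemma normE_scaleC:
  assumes "f \<in> spaceE"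
  shows "normE (c *\<^sub>C f) \<le> norm c * normE f"
  using assms
  by (intro normE_le) (auto simp: scaleC_def norm_mult intro!: mult_left_mono L1_le_normE norm_le_normE)

lemma normE_diff:
  assumes "f \<in> spaceE" "g \<in> spaceE"
  shows "normE (f - g) \<le> normE f + normE g"
proof -
  have "normE (f + (-1) *\<^sub>C g) \<le> normE f + normE ((-1) *\<^sub>C g)"
    by (intro normE_add assms spaceE_scaleC)
  moreover have "f + (-1) *\<^sub>C g = f - g"
    by (auto simp: scaleC_def)
  ultimately show ?thesis
    using normE_scaleC[OF assms(2), of "-1"] by simp
qed

lemma norm_phi_le: "norm (phi f) \<le> normE f"
  unfolding phi_def by (rule order_trans[OF integral_norm_bound L1_le_normE])

lemma normE_left_translation: "f \<in> spaceE \<Longrightarrow> normE (left_translation t f) \<le> normE f"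
  using lborel_integral_real_affine[of 1 "\<lambda>x. norm (f x)" t] L1_le_normE[of f]
  by (intro normE_le) (auto simp: left_translation_def add.commute norm_le_normE)

lemma normE_reflect: "f \<in> spaceE \<Longrightarrow> normE (\<lambda>x. f (- x)) \<le> normE f"
  using lborel_integral_real_affine[of "-1" "\<lambda>x. norm (f x)" 0] L1_le_normE[of f]
  by (intro normE_le) (auto simp: norm_le_normE)

section \<open>Convergence and L1 estimates in the norm of E\<close>

lemma tendsto_normE_zero:
  assumes "((\<lambda>t. LINT x|lborel. norm (h t x)) \<longlongrightarrow> 0) F"
    and "\<And>e. 0 < e \<Longrightarrow> \<forall>\<^sub>F t in F. \<forall>x. norm (h t x) \<le> e"
  shows "((\<lambda>t. normE (h t)) \<longlongrightarrow> 0) F"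
proof (rule tendstoI)
  fix e :: real assume "0 < e"
  \<comment> \<open>A pointwise bound passes to the supremum only as a weak inequality, so both
    parts are bounded by \<open>e / 2\<close> to end strictly below \<open>e\<close>.\<close>
  have "\<forall>\<^sub>F t in F. (LINT x|lborel. norm (h t x)) < e / 2"
    using order_tendstoD(2)[OF assms(1), of "e / 2"] \<open>0 < e\<close> by simp
  moreover have "\<forall>\<^sub>F t in F. \<forall>x. norm (h t x) \<le> e / 2"
    by (rule assms(2)) (use \<open>0 < e\<close> in simp)
  ultimately show "\<forall>\<^sub>F t in F. dist (normE (h t)) 0 < e"
  proof eventually_elim
    case (elim t)
    then have "normE (h t) \<le> e / 2"
      by (intro normE_le) auto
    then show ?case
      using \<open>0 < e\<close> normE_nonneg[of "h t"] by simp
  qed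
qed

text \<open>Scheffe's lemma concerns sequences, so the limit is tested along sequences avoiding
  \<open>a\<close>. An upper bound on the L1 norms can stand for their convergence, because Fatou's
  lemma gives the opposite inequality.\<close>

lemma L1_tendsto:
  fixes F :: "real \<Rightarrow> real \<Rightarrow> complex"
  assumes meas: "\<And>t. t \<in> S - {a} \<Longrightarrow> F t \<in> borel_measurable lborel"
    and f: "integrable lborel f"
    and lim: "\<And>x. ((\<lambda>t. F t x) \<longlongrightarrow> f x) (at a within S)"
    and le: "\<And>t. t \<in> S - {a} \<Longrightarrow> (\<integral>\<^sup>+x. norm (F t x) \<partial>lborel) \<le> (\<integral>\<^sup>+x. norm (f x) \<partial>lborel)"
  shows "((\<lambda>t. LINT x|lborel. norm (F t x - f x)) \<longlongrightarrow> 0) (at a within S)"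
  unfolding tendsto_at_iff_sequentially
proof (intro allI impI)
  fix X assume X: "\<forall>i. X i \<in> S - {a}" "X \<longlonglongrightarrow> a"
  have "(\<lambda>n. \<integral>\<^sup>+x. norm (F (X n) x - f x) \<partial>lborel) \<longlonglongrightarrow> 0"
  proof (rule Scheffe_lemma2)
    show "AE x in lborel. (\<lambda>n. F (X n) x) \<longlonglongrightarrow> f x"
      using lim X by (auto simp: tendsto_at_iff_sequentially comp_def)
  qed (use X meas f le in auto)
  \<comment> \<open>Both sides are 0 when the integral is infinite, so measurability suffices for
    this identity.\<close>
  moreover have "(LINT x|lborel. norm (F (X n) x - f x)) = enn2real (\<integral>\<^sup>+x. norm (F (X n) x - f x) \<partial>lborel)" for n
    using X meas[of "X n"] borel_measurable_integrable[OF f] by (intro integral_eq_nn_integral) auto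
  ultimately show "((\<lambda>t. LINT x|lborel. norm (F t x - f x)) \<circ> X) \<longlonglongrightarrow> 0"
    using tendsto_enn2real[of _ 0] by (simp add: comp_def)
qed

text \<open>Heine-Cantor settles a compact interval, and smallness near infinity settles the
  rest.\<close>

lemma spaceE_uniformly_continuous:
  assumes "f \<in> spaceE" "0 < e"
  obtains d where "0 < d" "\<And>x y. dist x y < d \<Longrightarrow> dist (f x) (f y) < e"
proof -
  obtain b where b: "\<And>x. b \<le> \<bar>x\<bar> \<Longrightarrow> norm (f x) < e / 2"
    using tendstoD[OF spaceE_D(3)[OF assms(1)], of "e / 2"] assms(2) by (auto simp: eventually_at_infinity)
  have "uniformly_continuous_on {-b-1..b+1} f"
    by (intro compact_uniformly_continuous continuous_on_subset[OF spaceE_D(2)[OF assms(1)]]) auto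
  then obtain d where d: "0 < d"
      "\<And>x y. x \<in> {-b-1..b+1} \<Longrightarrow> y \<in> {-b-1..b+1} \<Longrightarrow> dist y x < d \<Longrightarrow> dist (f y) (f x) < e"
    using assms(2) unfolding uniformly_continuous_on_def by metis
  show thesis
  proof
    \<comment> \<open>The cap 1 is the margin between \<open>{-b..b}\<close> and the enlarged
      interval: if one point leaves the latter, both lie where \<open>f\<close> is smaller than
      \<open>e / 2\<close>.\<close>
    show "0 < min d 1" using d by simp
    fix x y :: real assume *: "dist x y < min d 1"
    show "dist (f x) (f y) < e"
    proof (cases "x \<in> {-b-1..b+1} \<and> y \<in> {-b-1..b+1}")
      case True
      then show ?thesis using d(2)[of y x] * by auto
    next
      case False
      then have "b \<le> \<bar>x\<bar>" "b \<le> \<bar>y\<bar>"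
        using * by (auto simp: dist_real_def)
      then show ?thesis
        using b[of x] b[of y] norm_triangle_ineq4[of "f x" "f y"] by (simp add: dist_norm)
    qed
  qed
qed

text \<open>All translates have the same L1 norm, so \<open>L1_tendsto\<close> handles the L1 part;
  uniform continuity handles the supremum.\<close>

lemma left_translation_continuous:
  assumes "f \<in> spaceE"
  shows "((\<lambda>t. normE (left_translation t f - left_translation s f)) \<longlongrightarrow> 0) (at s within S)"
proof (rule tendsto_normE_zero)
  note [measurable] = spaceE_D(4)[OF assms]
  show "((\<lambda>t. LINT x|lborel. norm ((left_translation t f - left_translation s f) x)) \<longlongrightarrow> 0) (at s within S)"
    unfolding fun_diff_def
  proof (rule L1_tendsto)
    show "((\<lambda>t. left_translation t f x) \<longlongrightarrow> left_translation s f x) (at s within S)" for x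
    proof -
      have "isCont f (x + s)"
        using spaceE_D(2)[OF assms] by (simp add: continuous_on_eq_continuous_at)
      then show ?thesis
        unfolding left_translation_def by (rule isCont_tendsto_compose) (intro tendsto_intros)
    qed
    have "(\<integral>\<^sup>+x. norm (left_translation t f x) \<partial>lborel) = (\<integral>\<^sup>+x. norm (f x) \<partial>lborel)" for t
      using nn_integral_real_affine[of "\<lambda>x. norm (f x)" 1 t] by (simp add: left_translation_def add.commute)
    then show "(\<integral>\<^sup>+x. norm (left_translation t f x) \<partial>lborel) \<le> (\<integral>\<^sup>+x. norm (left_translation s f x) \<partial>lborel)" for t
      by simp
    show "integrable lborel (left_translation s f)"
      by (intro spaceE_D spaceE_left_translation assms)
    show "left_translation t f \<in> borel_measurable lborel" for t
      unfolding left_translation_def by measurable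
  qed
  fix e :: real assume "0 < e"
  then obtain d where d: "0 < d" "\<And>x y. dist x y < d \<Longrightarrow> dist (f x) (f y) < e"
    using spaceE_uniformly_continuous[OF assms] by metis
  have "\<forall>\<^sub>F t in at s within S. dist t s < d"
    using d(1) by (auto simp: eventually_at)
  then show "\<forall>\<^sub>F t in at s within S. \<forall>x. norm ((left_translation t f - left_translation s f) x) \<le> e"
    by eventually_elim (use d(2) in \<open>force simp: left_translation_def dist_norm intro: less_imp_le\<close>)
qed

text \<open>Young's inequality for an L1 kernel, by Tonelli and translation invariance. It serves
  both the averaging kernel of the difference quotients and the Laplace kernel of the
  resolvent.\<close>

lemma convolution_L1:
  fixes f g :: "real \<Rightarrow> complex" and k :: "real \<Rightarrow> real"
  assumes k: "integrable lborel k" "\<And>s. 0 \<le> k s" and g: "integrable lborel g"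
    and f: "f \<in> borel_measurable lborel"
    and le: "\<And>x. ennreal (norm (f x)) \<le> (\<integral>\<^sup>+s. k s * norm (g (x + s)) \<partial>lborel)"
  shows "(\<integral>\<^sup>+x. norm (f x) \<partial>lborel) \<le> ennreal (LINT s|lborel. k s) * (\<integral>\<^sup>+x. norm (g x) \<partial>lborel)"
proof -
  note [measurable] = borel_measurable_integrable[OF k(1)] borel_measurable_integrable[OF g] f
  have "(\<integral>\<^sup>+x. norm (f x) \<partial>lborel) \<le> (\<integral>\<^sup>+x. \<integral>\<^sup>+s. k s * norm (g (x + s)) \<partial>lborel \<partial>lborel)"
    by (intro nn_integral_mono le)
  also have "\<dots> = (\<integral>\<^sup>+s. \<integral>\<^sup>+x. k s * norm (g (x + s)) \<partial>lborel \<partial>lborel)"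
    by (rule lborel_pair.Fubini') measurable
  also have "\<dots> = (\<integral>\<^sup>+s. k s * (\<integral>\<^sup>+x. norm (g x) \<partial>lborel) \<partial>lborel)"
  proof (rule nn_integral_cong)
    fix s
    have "(\<integral>\<^sup>+x. norm (g x) \<partial>lborel) = (\<integral>\<^sup>+x. norm (g (x + s)) \<partial>lborel)"
      using nn_integral_real_affine[of "\<lambda>x. norm (g x)" 1 s] by (simp add: add.commute)
    then show "(\<integral>\<^sup>+x. k s * norm (g (x + s)) \<partial>lborel) = k s * (\<integral>\<^sup>+x. norm (g x) \<partial>lborel)"
      using k(2) by (simp add: ennreal_mult nn_integral_cmult)
  qed
  also have "\<dots> = ennreal (LINT s|lborel. k s) * (\<integral>\<^sup>+x. norm (g x) \<partial>lborel)"
    using k by (simp add: nn_integral_multc nn_integral_eq_integral)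
  finally show ?thesis .
qed

section \<open>Derivatives and the generator of translation on E\<close>

lemma has_vector_derivative_iff_quotient:
  fixes f :: "real \<Rightarrow> complex"
  shows "(f has_vector_derivative d) (at x) \<longleftrightarrow>
    ((\<lambda>h. complex_of_real (1 / h) * (f (x + h) - f x)) \<longlongrightarrow> d) (at 0)"
proof -
  have "norm (f (x + h) - f x - h *\<^sub>R d) / norm h = norm (complex_of_real (1 / h) * (f (x + h) - f x) - d)"
    if "h \<noteq> 0" for h :: real
  proof -
    have "f (x + h) - f x - h *\<^sub>R d = complex_of_real h * (complex_of_real (1 / h) * (f (x + h) - f x) - d)"
      using that by (simp add: field_simps scaleR_conv_of_real)
    then show ?thesis
      using that by (simp add: norm_mult del: of_real_divide)
  qed
  then have "((\<lambda>h. norm (f (x + h) - f x - h *\<^sub>R d) / norm h) \<longlongrightarrow> 0) (at 0) \<longleftrightarrow>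
      ((\<lambda>h. norm (complex_of_real (1 / h) * (f (x + h) - f x) - d)) \<longlongrightarrow> 0) (at 0)"
    by (intro tendsto_cong) (auto simp: eventually_at_filter)
  then show ?thesis
    by (simp add: has_vector_derivative_def has_derivative_at bounded_linear_scaleR_left
        tendsto_norm_zero_iff LIM_zero_iff del: of_real_divide)
qed

lemma has_vector_derivative_shift:
  assumes "(f has_vector_derivative d) (at (x + s))"
  shows "((\<lambda>s. f (x + s)) has_vector_derivative d) (at s within S)"
proof -
  have "((\<lambda>s. x + s) has_vector_derivative 1) (at s within S)"
    by (auto intro!: derivative_eq_intros)
  then show ?thesis
    using vector_diff_chain_within[of "\<lambda>s. x + s" 1 s S f d] assms
    by (simp add: comp_def has_vector_derivative_at_within)
qed

text \<open>The fundamental theorem on the whole line, with limit 0 at both ends. It places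
  derivatives in the kernel of \<open>phi\<close>, and later gives the obstruction on the imaginary
  axis.\<close>

lemma integral_derivative_eq_0:
  fixes F h :: "real \<Rightarrow> complex"
  assumes "\<And>x. (F has_vector_derivative h x) (at x)" "continuous_on UNIV h"
    and "integrable lborel h" "(F \<longlongrightarrow> 0) at_infinity"
  shows "(LINT x|lborel. h x) = 0"
proof -
  have "(LBINT x=-\<infinity>..\<infinity>. h x) = 0 - 0"
  proof (rule interval_integral_FTC_integrable)
    show "set_integrable lborel (einterval (-\<infinity>) \<infinity>) h"
      using assms(3) by (simp add: set_integrable_def)
    show "((F \<circ> real_of_ereal) \<longlongrightarrow> 0) (at_right (-\<infinity>))" "((F \<circ> real_of_ereal) \<longlongrightarrow> 0) (at_left \<infinity>)"
      using filterlim_mono[OF assms(4) order_refl at_bot_le_at_infinity]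
        filterlim_mono[OF assms(4) order_refl at_top_le_at_infinity]
      by (simp_all add: ereal_tendsto_simps)
  qed (use assms(1,2) in \<open>auto simp: continuous_on_eq_continuous_at\<close>)
  then show ?thesis
    by (simp add: interval_lebesgue_integral_def set_lebesgue_integral_def)
qed

lemma left_translation_quotient_tendsto:
  assumes f: "f \<in> spaceE" and g: "g \<in> spaceE"
    and deriv: "\<And>x. (f has_vector_derivative g x) (at x)"
  shows "has_generator_value normE left_translation f g"
  unfolding has_generator_value_def
proof (rule tendsto_normE_zero)
  note [measurable] = spaceE_D(4)[OF f] spaceE_D(4)[OF g]
  define q where "q t x = complex_of_real (1 / t) * (f (x + t) - f x)" for t x
  have q: "(complex_of_real (1 / t) *\<^sub>C (left_translation t f - f) - g) x = q t x - g x" for t x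
    by (simp add: scaleC_def left_translation_def q_def)
  have "((\<lambda>t. LINT x|lborel. norm (q t x - g x)) \<longlongrightarrow> 0) (at_right 0)"
  proof (rule L1_tendsto)
    show "((\<lambda>t. q t x) \<longlongrightarrow> g x) (at_right 0)" for x
      using deriv[of x] unfolding has_vector_derivative_iff_quotient q_def
      by (rule filterlim_mono[OF _ order_refl]) (simp add: at_le)
    show "(\<integral>\<^sup>+x. norm (q t x) \<partial>lborel) \<le> (\<integral>\<^sup>+x. norm (g x) \<partial>lborel)" if "t \<in> {0<..} - {0}" for t
    proof -
      have t: "0 < t" using that by simp
      \<comment> \<open>Density of the uniform distribution on \<open>{0..t}\<close>:
        \<open>q t x\<close> is the mean of \<open>g (x + s)\<close> against it, and its mass 1
        gives the L1 bound without any extra factor.\<close>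
      define k where "k = (\<lambda>s. indicator {0..t} s / t :: real)"
      have k: "integrable lborel k" "\<And>s. 0 \<le> k s" "(LINT s|lborel. k s) = 1"
        using t by (auto simp: k_def)
      have *: "integrable lborel (\<lambda>s. k s *\<^sub>R g (x + s)) \<and> (LINT s|lborel. k s *\<^sub>R g (x + s)) = q t x" for x
      proof -
        have cont: "continuous_on {0..t} (\<lambda>s. g (x + s))"
          by (rule continuous_on_compose2[OF spaceE_D(2)[OF g]]) (auto intro!: continuous_intros)
        have eq: "k s *\<^sub>R g (x + s) = (1 / t) *\<^sub>R (indicator {0..t} s *\<^sub>R g (x + s))" for s
          by (simp add: k_def)
        have "(LINT s|lborel. indicator {0..t} s *\<^sub>R g (x + s)) = f (x + t) - f (x + 0)"
          using t cont by (intro integral_FTC_atLeastAtMost has_vector_derivative_shift deriv) auto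
        moreover have "integrable lborel (\<lambda>s. indicator {0..t} s *\<^sub>R g (x + s))"
          using borel_integrable_atLeastAtMost'[OF cont] by (simp add: set_integrable_def)
        ultimately show ?thesis
          unfolding eq by (simp add: q_def scaleR_conv_of_real)
      qed
      have "(\<integral>\<^sup>+x. norm (q t x) \<partial>lborel) \<le> ennreal (LINT s|lborel. k s) * (\<integral>\<^sup>+x. norm (g x) \<partial>lborel)"
      proof (rule convolution_L1)
        show "ennreal (norm (q t x)) \<le> (\<integral>\<^sup>+s. k s * norm (g (x + s)) \<partial>lborel)" for x
          using integral_norm_bound_ennreal[OF conjunct1[OF *[of x]]] k(2) by (simp add: *)
        show "q t \<in> borel_measurable lborel"
          unfolding q_def by measurable
      qed (use k spaceE_D(1)[OF g] in auto)
      then show ?thesis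
        by (simp add: k)
    qed
    show "q t \<in> borel_measurable lborel" for t
      unfolding q_def by measurable
  qed (rule spaceE_D(1)[OF g])
  then show "((\<lambda>t. LINT x|lborel. norm ((complex_of_real (1 / t) *\<^sub>C (left_translation t f - f) - g) x)) \<longlongrightarrow> 0) (at_right 0)"
    by (simp only: q)
  fix e :: real assume "0 < e"
  then obtain d where d: "0 < d" "\<And>x y. dist x y < d \<Longrightarrow> dist (g x) (g y) < e"
    using spaceE_uniformly_continuous[OF g] by metis
  have "\<forall>\<^sub>F t in at_right 0. 0 < t \<and> t < d"
    using d(1) by (auto simp: eventually_at_right_field)
  then show "\<forall>\<^sub>F t in at_right 0. \<forall>x. norm ((complex_of_real (1 / t) *\<^sub>C (left_translation t f - f) - g) x) \<le> e"
  proof (eventually_elim, intro allI)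
    fix t x assume t: "0 < t \<and> t < d"
    \<comment> \<open>Mean value inequality: \<open>g\<close> stays within \<open>e\<close> of
      \<open>g x\<close> on \<open>{x..x+t}\<close>, with \<open>d\<close> independent of
      \<open>x\<close>. Dividing by \<open>t\<close> then bounds the quotient uniformly.\<close>
    have "norm (f (x + t) - f x - (x + t - x) *\<^sub>R g x) \<le> norm (x + t - x) * e"
    proof (rule vector_differentiable_bound_linearization)
      show "norm (g y - g x) \<le> e" if "y \<in> {x..x+t}" for y
        using d(2)[of y x] t that by (force simp: dist_norm intro: less_imp_le)
    qed (use t in \<open>auto simp: closed_segment_eq_real_ivl deriv has_vector_derivative_at_within\<close>)
    moreover have "f (x + t) - f x - (x + t - x) *\<^sub>R g x = complex_of_real t * (q t x - g x)"
      using t by (simp add: q_def field_simps scaleR_conv_of_real)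
    ultimately show "norm ((complex_of_real (1 / t) *\<^sub>C (left_translation t f - f) - g) x) \<le> e"
      using t by (simp only: q) (simp add: norm_mult)
  qed
qed

text \<open>
  The generator limit only gives right derivatives directly. Being uniform in \<open>x\<close>, it also
  controls the backward quotient, which is the forward quotient at \<open>x - t\<close>.
\<close>

lemma has_generator_value_imp_derivative:
  assumes f: "f \<in> spaceE" and g: "g \<in> spaceE"
    and "has_generator_value normE left_translation f g"
  shows "(f has_vector_derivative g x) (at x)"
proof -
  define q where "q t x = complex_of_real (1 / t) * (f (x + t) - f x)" for t x
  define D where "D t = normE (complex_of_real (1 / t) *\<^sub>C (left_translation t f - f) - g)" for t
  have D: "(D \<longlongrightarrow> 0) (at_right 0)"
    using assms(3) unfolding has_generator_value_def D_def .
  have le: "norm (q t y - g y) \<le> D t" for t y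
  proof -
    have "complex_of_real (1 / t) *\<^sub>C (left_translation t f - f) - g \<in> spaceE"
      by (intro spaceE_diff spaceE_scaleC spaceE_left_translation f g)
    from norm_le_normE[OF this, of y] show ?thesis
      by (simp add: D_def q_def scaleC_def left_translation_def)
  qed
  have "((\<lambda>t. q t x - g x) \<longlongrightarrow> 0) (at_right 0)"
    by (rule Lim_null_comparison[OF _ D]) (simp add: le)
  then have right: "((\<lambda>t. q t x) \<longlongrightarrow> g x) (at_right 0)"
    by (simp add: LIM_zero_iff)
  have "((\<lambda>t. q t (x - t) - g (x - t)) \<longlongrightarrow> 0) (at_right 0)"
    by (rule Lim_null_comparison[OF _ D]) (simp add: le)
  moreover have "((\<lambda>t. g (x - t)) \<longlongrightarrow> g x) (at_right 0)"
  proof -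
    have "isCont g x"
      using spaceE_D(2)[OF g] by (simp add: continuous_on_eq_continuous_at)
    then show ?thesis
      by (rule isCont_tendsto_compose) (auto intro!: tendsto_eq_intros)
  qed
  ultimately have "((\<lambda>t. q t (x - t)) \<longlongrightarrow> g x) (at_right 0)"
    using tendsto_add by fastforce
  moreover have "q t (x - t) = q (- t) x" for t
    by (cases "t = 0") (auto simp: q_def field_simps)
  ultimately have "((\<lambda>t. q t x) \<longlongrightarrow> g x) (at_left 0)"
    by (simp add: filterlim_at_left_to_right)
  with right show ?thesis
    by (simp add: has_vector_derivative_iff_quotient q_def filterlim_at_split del: of_real_divide)
qed

lemma has_generator_value_left_translation_iff:
  "f \<in> spaceE \<Longrightarrow> g \<in> spaceE \<Longrightarrow> has_generator_value normE left_translation f g \<longleftrightarrow>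
    (\<forall>x. (f has_vector_derivative g x) (at x))"
  using has_generator_value_imp_derivative left_translation_quotient_tendsto by blast

section \<open>Exponentials and the equation z f - f' = g\<close>

lemma exp_mult_has_vector_derivative:
  fixes z :: complex
  shows "((\<lambda>x. exp (z * of_real x)) has_vector_derivative z * exp (z * of_real x)) (at x)"
  by (rule has_vector_derivative_real_field) (auto intro!: derivative_eq_intros)

text \<open>The product of \<open>f\<close> with the integrating factor
  \<open>exp (- z * of_real x)\<close> has derivative zero, hence is a constant \<open>c\<close>.
  This serves injectivity of the resolvent equation and, with \<open>z = 0\<close>, the
  eigenspace.\<close>

lemma eigenfunction_eq_0:
  assumes f: "f \<in> spaceE" and deriv: "\<And>x. (f has_vector_derivative z * f x) (at x)"
  shows "f = 0"
proof -
  have "((\<lambda>x. exp (- z * of_real x) * f x) has_vector_derivative 0) (at x within UNIV)" for x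
    using has_vector_derivative_mult[OF exp_mult_has_vector_derivative[of "- z" x] deriv[of x]]
    by (simp add: algebra_simps)
  then obtain c where c: "\<And>x. exp (- z * of_real x) * f x = c"
    using has_vector_derivative_zero_constant[of UNIV "\<lambda>x. exp (- z * of_real x) * f x"] by auto
  have f_eq: "f x = exp (z * of_real x) * c" for x
    using c[of x] by (auto simp: exp_minus field_simps)
  have "c = 0"
  proof (rule ccontr)
    assume "c \<noteq> 0"
    then obtain b where b: "\<And>x. b \<le> \<bar>x\<bar> \<Longrightarrow> norm (f x) < norm c"
      using tendstoD[OF spaceE_D(3)[OF f], of "norm c"] by (auto simp: eventually_at_infinity)
    \<comment> \<open>The side is chosen so that \<open>exp (z * of_real x)\<close> has modulus at
      least 1, and the distance from 0 so that \<open>f\<close> is already smaller than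
      \<open>norm c\<close> there.\<close>
    define x where "x = (if 0 \<le> Re z then \<bar>b\<bar> else - \<bar>b\<bar>)"
    have "0 \<le> Re (z * of_real x)"
      by (auto simp: x_def mult_nonpos_nonneg)
    then have "norm c \<le> norm (f x)"
      by (simp add: f_eq norm_mult mult_le_cancel_right1)
    moreover have "b \<le> \<bar>x\<bar>"
      by (simp add: x_def)
    ultimately show False
      using b[of x] by simp
  qed
  then show ?thesis
    using f_eq by (auto simp: fun_eq_iff)
qed

lemma integral_exp_atLeast_0:
  assumes "0 < (a::real)"
  shows "integrable lborel (\<lambda>s. indicator {0..} s * exp (- a * s))"
    and "(LINT s|lborel. indicator {0..} s * exp (- a * s)) = 1 / a"
proof -
  have eq: "indicator {0..} s * exp (- a * s) = (if s \<in> {0..} then exp (- a * s) else 0)" for s :: real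
    by (auto simp: indicator_def)
  have "integrable lebesgue (\<lambda>s. indicator {0..} s *\<^sub>R exp (- a * s))"
    using assms
    by (intro nonnegative_absolutely_integrable_1[unfolded set_integrable_def] integrable_on_exp_minus_to_infinity) auto
  then show int: "integrable lborel (\<lambda>s. indicator {0..} s * exp (- a * s))"
    by (simp add: integrable_completion)
  have "((\<lambda>s. indicator {0..} s * exp (- a * s)) has_integral 1 / a) UNIV"
    using has_integral_exp_minus_to_infinity[OF assms, of 0] unfolding eq by (simp only: has_integral_restrict_UNIV) simp
  then show "(LINT s|lborel. indicator {0..} s * exp (- a * s)) = 1 / a"
    using has_integral_integral_lborel[OF int] has_integral_unique by blast
qed

text \<open>For \<open>y\<close> to the right of a fixed \<open>a\<close>, the integral over
  \<open>{y..}\<close> is a constant minus the integral over \<open>{a..y}\<close>, which leaves the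
  fundamental theorem on a compact interval.\<close>

lemma has_vector_derivative_integral_atLeast:
  fixes h :: "real \<Rightarrow> complex"
  assumes "continuous_on UNIV h" "\<And>x. h integrable_on {x..}"
  shows "((\<lambda>x. integral {x..} h) has_vector_derivative - h x) (at x)"
proof -
  \<comment> \<open>Strictly left of \<open>x\<close>, so that the splitting holds in a whole
    neighbourhood of \<open>x\<close> and the derivative is two-sided.\<close>
  define a where "a = x - 1"
  have eq: "integral {y..} h = integral {a..} h - integral {a..y} h" if "a \<le> y" for y
  proof -
    have "integral ({a..y} \<union> {y..}) h = integral {a..y} h + integral {y..} h"
    proof (rule integral_Un)
      have "{a..y} \<inter> {y..} = {y}" using that by auto
      then show "negligible ({a..y} \<inter> {y..})" by simp
    qed (auto intro!: assms integrable_continuous_interval continuous_on_subset[OF assms(1)])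
    moreover have "{a..y} \<union> {y..} = {a..}" using that by auto
    ultimately show ?thesis by simp
  qed
  have "((\<lambda>y. integral {a..y} h) has_vector_derivative h x) (at x within {a..x + 1})"
    by (rule integral_has_vector_derivative[OF continuous_on_subset[OF assms(1)]]) (auto simp: a_def)
  then have "((\<lambda>y. integral {a..y} h) has_vector_derivative h x) (at x)"
    by (simp add: at_within_Icc_at a_def)
  then have deriv: "((\<lambda>y. integral {a..} h - integral {a..y} h) has_vector_derivative - h x) (at x)"
    by (auto intro!: derivative_eq_intros)
  have "x \<in> {a<..}"
    by (simp add: a_def)
  from has_vector_derivative_transform_within_open[OF deriv open_greaterThan this] show ?thesis
    by (simp only: eq[symmetric] greaterThan_iff less_imp_le)
qed

text \<open>The solution is the Laplace transform of the translation orbit of \<open>g\<close>: the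
  integral of \<open>exp (- z s) g (x + s)\<close> over \<open>s >= 0\<close>. The modulus of its
  kernel has mass \<open>1 / Re z\<close>, which bounds the supremum and the L1 norm alike.\<close>

lemma resolvent_Re_pos:
  assumes z: "0 < Re z" and g: "g \<in> spaceE"
  shows "\<exists>f\<in>spaceE. (\<forall>x. (f has_vector_derivative z * f x - g x) (at x)) \<and> normE f \<le> normE g / Re z"
proof -
  note [measurable] = spaceE_D(4)[OF g]
  define k where "k s = indicator {0..} s * exp (- Re z * s)" for s :: real
  have k: "integrable lborel k" "(LINT s|lborel. k s) = 1 / Re z" "\<And>s. 0 \<le> k s"
    using integral_exp_atLeast_0[OF z] by (auto simp: k_def[abs_def])
  define F where "F x s = indicator {0..} s *\<^sub>R (exp (- z * of_real s) * g (x + s))" for x s :: real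
  define f where "f x = (LINT s|lborel. F x s)" for x
  have F_meas [measurable]: "F x \<in> borel_measurable borel" for x
    unfolding F_def by measurable
  have norm_F: "norm (F x s) = k s * norm (g (x + s))" for x s
    by (simp add: F_def k_def norm_mult)
  have F_le: "norm (F x s) \<le> k s * normE g" for x s
    unfolding norm_F by (intro mult_left_mono norm_le_normE g k)
  have int_F: "integrable lborel (F x)" for x
    by (rule Bochner_Integration.integrable_bound[of _ "\<lambda>s. k s * normE g"])
      (use k F_le[of x] in \<open>auto simp: abs_mult normE_nonneg\<close>)

  \<comment> \<open>Substituting \<open>y = x + s\<close> moves \<open>x\<close> into the limit of
    integration: \<open>f x\<close> becomes \<open>exp (z x)\<close> times the integral of
    \<open>h\<close> over \<open>{x..}\<close>, which can be differentiated.\<close>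
  define h where "h y = exp (- z * of_real y) * g y" for y
  have cont_h: "continuous_on UNIV h"
    unfolding h_def by (intro continuous_intros spaceE_D g)
  have F_h: "F x s = exp (z * of_real x) * (indicator {x..} (x + s) *\<^sub>R h (x + s))" for x s
    by (simp add: F_def h_def indicator_def exp_add[symmetric] algebra_simps)
  have int_h: "integrable lborel (\<lambda>y. indicator {x..} y *\<^sub>R h y)" for x
  proof -
    have "integrable lborel (\<lambda>s. exp (- z * of_real x) * F x s)"
      using int_F by simp
    also have "(\<lambda>s. exp (- z * of_real x) * F x s) = (\<lambda>s. indicator {x..} (x + 1 * s) *\<^sub>R h (x + 1 * s))"
      by (simp add: F_h fun_eq_iff exp_minus)
    finally show ?thesis
      by (subst (asm) lborel_integrable_real_affine_iff) auto
  qed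
  have h_integrable: "h integrable_on {x..}"
    and h_integral: "(LINT y|lborel. indicator {x..} y *\<^sub>R h y) = integral {x..} h" for x
    using set_borel_integral_eq_integral[of "{x..}" h] int_h[of x]
    by (auto simp: set_integrable_def set_lebesgue_integral_def)
  have f_eq: "f x = exp (z * of_real x) * integral {x..} h" for x
    using lborel_integral_real_affine[of 1 "\<lambda>y. indicator {x..} y *\<^sub>R h y" x]
    by (simp add: f_def F_h h_integral del: mult_scaleR_right)
  have deriv: "(f has_vector_derivative z * f x - g x) (at x)" for x
  proof -
    have "(f has_vector_derivative exp (z * of_real x) * (- h x) + (z * exp (z * of_real x)) * integral {x..} h) (at x)"
      unfolding f_eq[abs_def]
      by (intro has_vector_derivative_mult exp_mult_has_vector_derivative
          has_vector_derivative_integral_atLeast cont_h h_integrable)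
    moreover have "exp (z * of_real x) * (- h x) = - g x"
      by (simp add: h_def exp_minus)
    ultimately show ?thesis
      by (simp add: f_eq algebra_simps)
  qed
  then have cont: "continuous_on UNIV f"
    by (meson continuous_at_imp_continuous_on has_vector_derivative_continuous)
  then have [measurable]: "f \<in> borel_measurable borel"
    by (rule borel_measurable_continuous_onI)

  have sup: "norm (f x) \<le> normE g / Re z" for x
  proof -
    have "norm (f x) \<le> (LINT s|lborel. k s * normE g)"
      unfolding f_def using k F_le int_F by (intro order_trans[OF integral_norm_bound] integral_mono) auto
    then show ?thesis
      by (simp add: k(2))
  qed
  \<comment> \<open>The factor \<open>c\<close> lets one dominated convergence argument along
    \<open>at_top\<close> serve both ends of the line, with \<open>c\<close> equal to 1 and to
    -1.\<close>
  have lim: "((\<lambda>x. f (c * x)) \<longlongrightarrow> 0) at_top" if "c \<noteq> 0" for c :: real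
  proof -
    have "((\<lambda>x. LINT s|lborel. F (c * x) s) \<longlongrightarrow> (LINT (s::real)|lborel. 0)) at_top"
    proof (rule integral_dominated_convergence_at_top[where w = "\<lambda>s. k s * normE g"])
      show "AE s in lborel. ((\<lambda>x. F (c * x) s) \<longlongrightarrow> 0) at_top"
      proof (intro always_eventually allI)
        fix s :: real
        have "filterlim (\<lambda>x. c * x + s) at_infinity at_top"
          by (intro tendsto_add_filterlim_at_infinity'[OF _ tendsto_const]
              tendsto_mult_filterlim_at_infinity[OF tendsto_const that] filterlim_at_top_imp_at_infinity filterlim_ident)
        then have "((\<lambda>x. g (c * x + s)) \<longlongrightarrow> 0) at_top"
          using spaceE_D(3)[OF g] by (rule filterlim_compose[rotated])
        then show "((\<lambda>x. F (c * x) s) \<longlongrightarrow> 0) at_top"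
          unfolding F_def by (auto intro!: tendsto_eq_intros)
      qed
    qed (use k F_le in auto)
    then show ?thesis
      by (simp add: f_def)
  qed
  have lim_f: "(f \<longlongrightarrow> 0) at_infinity"
    using lim[of 1] lim[of "-1"]
    by (simp add: at_infinity_eq_at_top_bot filterlim_sup filterlim_at_bot_mirror)

  \<comment> \<open>The estimate is made for the extended integral first, since integrability of
    \<open>f\<close> is deduced from its finiteness.\<close>
  have L1: "(\<integral>\<^sup>+x. norm (f x) \<partial>lborel) \<le> ennreal (1 / Re z) * (\<integral>\<^sup>+x. norm (g x) \<partial>lborel)"
  proof -
    have "ennreal (norm (f x)) \<le> (\<integral>\<^sup>+s. k s * norm (g (x + s)) \<partial>lborel)" for x
      using integral_norm_bound_ennreal[OF int_F[of x]] by (simp add: norm_F f_def)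
    then show ?thesis
      using convolution_L1[OF k(1,3) spaceE_D(1)[OF g], of f] k(2) by simp
  qed
  also have "\<dots> = ennreal (1 / Re z * (LINT x|lborel. norm (g x)))"
    using z spaceE_D(1)[OF g] by (simp add: nn_integral_eq_integral ennreal_mult[symmetric])
  finally have L1: "(\<integral>\<^sup>+x. norm (f x) \<partial>lborel) \<le> ennreal ((LINT x|lborel. norm (g x)) / Re z)"
    by simp
  then have int_f: "integrable lborel f"
    by (intro integrableI_bounded) (auto simp: le_less_trans[OF _ ennreal_less_top])
  then have "(LINT x|lborel. norm (f x)) \<le> (LINT x|lborel. norm (g x)) / Re z"
    using L1 z by (simp add: nn_integral_eq_integral)
  also have "\<dots> \<le> normE g / Re z"
    using z by (intro divide_right_mono L1_le_normE) auto
  finally have "normE f \<le> normE g / Re z"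
    by (rule normE_le) (rule sup)
  moreover have "f \<in> spaceE"
    using int_f cont lim_f by (simp add: spaceE_def)
  ultimately show ?thesis
    using deriv by blast
qed

text \<open>For \<open>Re z < 0\<close>, reflection turns the equation for \<open>z\<close> into one
  for \<open>- z\<close>. The chain rule reverses the sign of the derivative, which explains the
  factor -1 in \<open>g'\<close>.\<close>

lemma resolvent_Re_nonzero:
  assumes z: "Re z \<noteq> 0" and g: "g \<in> spaceE"
  obtains f where "f \<in> spaceE" "\<And>x. (f has_vector_derivative z * f x - g x) (at x)"
    "normE f \<le> normE g / \<bar>Re z\<bar>"
proof (cases "0 < Re z")
  case True
  then show ?thesis
    using resolvent_Re_pos[OF True g] that by auto
next
  case False
  define g' where "g' = (- 1) *\<^sub>C (\<lambda>x. g (- x))"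
  have g': "g' \<in> spaceE"
    unfolding g'_def by (intro spaceE_scaleC spaceE_reflect g)
  have "normE g' \<le> normE g"
    using normE_scaleC[OF spaceE_reflect[OF g], of "- 1"] normE_reflect[OF g] by (simp add: g'_def)
  moreover have z': "0 < Re (- z)"
    using False z by simp
  ultimately have "normE g' / Re (- z) \<le> normE g / \<bar>Re z\<bar>"
    by (simp add: divide_right_mono_neg)
  moreover obtain u where u: "u \<in> spaceE" "\<And>x. (u has_vector_derivative - z * u x - g' x) (at x)"
    "normE u \<le> normE g' / Re (- z)"
    using resolvent_Re_pos[OF z' g'] by blast
  ultimately have le: "normE u \<le> normE g / \<bar>Re z\<bar>"
    by linarith
  show ?thesis
  proof (rule that)
    show "(\<lambda>x. u (- x)) \<in> spaceE"
      by (rule spaceE_reflect[OF u(1)])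
    show "((\<lambda>x. u (- x)) has_vector_derivative z * u (- x) - g x) (at x)" for x
    proof -
      have "(uminus has_vector_derivative - 1) (at x)"
        by (auto intro!: derivative_eq_intros)
      from vector_diff_chain_at[OF this u(2)] show ?thesis
        by (simp add: comp_def g'_def scaleC_def)
    qed
    show "normE (\<lambda>x. u (- x)) \<le> normE g / \<bar>Re z\<bar>"
      using normE_reflect[OF u(1)] le by simp
  qed
qed

section \<open>The translation semigroup on G and its generator\<close>

lemma phi_derivative_eq_0:
  assumes "f \<in> spaceE" "g \<in> spaceE" "\<And>x. (f has_vector_derivative g x) (at x)"
  shows "phi g = 0"
  unfolding phi_def using integral_derivative_eq_0[OF assms(3)] assms(1,2) by (simp add: spaceE_D)

lemma spaceG_D: "f \<in> spaceG \<Longrightarrow> f \<in> spaceE" "f \<in> spaceG \<Longrightarrow> phi f = 0"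
  by (auto simp: spaceG_def)

lemma spaceG_left_translation: "f \<in> spaceG \<Longrightarrow> left_translation t f \<in> spaceG"
  by (simp add: spaceG_def spaceE_left_translation phi_left_translation)

lemma left_translation_add: "left_translation t (f + g) = left_translation t f + left_translation t g"
  and left_translation_scaleC: "left_translation t (c *\<^sub>C f) = c *\<^sub>C left_translation t f"
  and left_translation_0: "left_translation 0 f = f"
  and left_translation_left_translation:
    "left_translation s (left_translation t f) = left_translation (s + t) f"
  by (simp_all add: left_translation_def scaleC_def fun_eq_iff add.assoc)

lemma C0_semigroup_left_translation: "C0_semigroup spaceG normE left_translation"
proof -
  have "\<exists>C. \<forall>f\<in>spaceG. normE (left_translation t f) \<le> C * normE f" for t
    using normE_left_translation by (intro exI[of _ 1]) (auto simp: spaceG_D)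
  then show ?thesis
    unfolding C0_semigroup_def
    by (auto simp: subspace_spaceG spaceG_left_translation left_translation_add left_translation_scaleC
        left_translation_0 left_translation_left_translation spaceG_D left_translation_continuous)
qed

text \<open>A derivative lying in \<open>spaceE\<close> has integral zero and hence lies in
  \<open>spaceG\<close>, so it may be sought in the larger space.\<close>

lemma domB_iff:
  "f \<in> domB \<longleftrightarrow> f \<in> spaceG \<and> (\<exists>g\<in>spaceE. \<forall>x. (f has_vector_derivative g x) (at x))"
  unfolding domB_def generator_domain_def
  using has_generator_value_left_translation_iff phi_derivative_eq_0[of f]
  by (auto simp: spaceG_def)

text \<open>Pointwise uniqueness of derivatives gives the \<open>THE\<close> in
  \<open>generator\<close> a unique candidate. \<open>X\<close> is instantiated by
  \<open>spaceG\<close> for \<open>opB\<close> and by \<open>spaceE\<close> for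
  \<open>opA\<close>.\<close>

lemma generator_left_translation_eq:
  assumes "f \<in> spaceE" "g \<in> X" "X \<subseteq> spaceE" "\<And>x. (f has_vector_derivative g x) (at x)"
  shows "generator X normE left_translation f = g"
  unfolding generator_def
proof (rule the_equality)
  show "g \<in> X \<and> has_generator_value normE left_translation f g"
    using assms has_generator_value_left_translation_iff by blast
  show "h = g" if "h \<in> X \<and> has_generator_value normE left_translation f h" for h
  proof
    have "h \<in> spaceE" using that assms(3) by auto
    then have "(f has_vector_derivative h x) (at x)" for x
      using that has_generator_value_imp_derivative[OF assms(1)] by blast
    then show "h x = g x" for x
      using assms(4) vector_derivative_unique_at by blast
  qed
qed

lemma opB_eq:
  assumes "f \<in> spaceE" "g \<in> spaceE" "\<And>x. (f has_vector_derivative g x) (at x)"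
  shows "opB f = g"
  unfolding opB_def
  by (rule generator_left_translation_eq) (use assms phi_derivative_eq_0 in \<open>auto simp: spaceG_def\<close>)

lemma domB_D:
  assumes "f \<in> domB"
  shows "f \<in> spaceG" "opB f \<in> spaceG" "(f has_vector_derivative opB f x) (at x)"
proof -
  obtain g where g: "f \<in> spaceG" "g \<in> spaceE" "\<And>x. (f has_vector_derivative g x) (at x)"
    using assms domB_iff by blast
  moreover have "opB f = g"
    using g by (intro opB_eq) (auto simp: spaceG_D)
  moreover have "phi g = 0"
    using g by (intro phi_derivative_eq_0[of f]) (auto simp: spaceG_D)
  ultimately show "f \<in> spaceG" "opB f \<in> spaceG" "(f has_vector_derivative opB f x) (at x)"
    by (auto simp: spaceG_def)
qed

lemma opB_eq_ddx: "f \<in> domB \<Longrightarrow> opB f = ddx f"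
  by (auto simp: ddx_def fun_eq_iff intro!: vector_derivative_at[symmetric] domB_D)

text \<open>\<open>vector_derivative\<close> picks an arbitrary value where no derivative exists, so
  \<open>ddx f\<close> stands for df/dx only under the differentiability condition. Under it,
  \<open>ddx f\<close> is the witness for \<open>domB_iff\<close>.\<close>

lemma domB_eq: "domB = {f \<in> spaceG. (\<forall>x. f differentiable (at x)) \<and> ddx f \<in> spaceG}"
proof (intro set_eqI iffI)
  show "f \<in> {f \<in> spaceG. (\<forall>x. f differentiable (at x)) \<and> ddx f \<in> spaceG}" if "f \<in> domB" for f
    using domB_D[OF that] opB_eq_ddx[OF that] by (auto intro: differentiableI_vector)
  show "f \<in> domB" if "f \<in> {f \<in> spaceG. (\<forall>x. f differentiable (at x)) \<and> ddx f \<in> spaceG}" for f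
    using that unfolding domB_iff
    by (auto intro!: bexI[of _ "ddx f"] simp: spaceG_D ddx_def vector_derivative_works[symmetric])
qed

lemma subspace_domB: "cfun.subspace domB"
proof (rule cfun.subspaceI)
  show "0 \<in> domB"
    unfolding domB_iff using cfun.subspace_0[OF subspace_spaceE] cfun.subspace_0[OF subspace_spaceG]
    by (auto simp: zero_fun_def intro!: bexI[of _ "\<lambda>_. 0"])
  fix f assume f: "f \<in> domB"
  show "f + g \<in> domB" if g: "g \<in> domB" for g
    unfolding domB_iff
  proof (intro conjI bexI allI)
    show "((f + g) has_vector_derivative (opB f + opB g) x) (at x)" for x
      unfolding plus_fun_def by (intro has_vector_derivative_add domB_D f g)
    show "f + g \<in> spaceG"
      by (intro cfun.subspace_add[OF subspace_spaceG] domB_D f g)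
    show "opB f + opB g \<in> spaceE"
      by (intro spaceE_add spaceG_D domB_D f g)
  qed
  show "c *\<^sub>C f \<in> domB" for c
    unfolding domB_iff
  proof (intro conjI bexI allI)
    show "((c *\<^sub>C f) has_vector_derivative (c *\<^sub>C opB f) x) (at x)" for x
      unfolding scaleC_def by (intro has_vector_derivative_mult_right domB_D f)
    show "c *\<^sub>C f \<in> spaceG"
      by (intro cfun.subspace_scale[OF subspace_spaceG] domB_D f)
    show "c *\<^sub>C opB f \<in> spaceE"
      by (intro spaceE_scaleC spaceG_D domB_D f)
  qed
qed

lemma opB_0: "opB 0 = 0"
  by (rule opB_eq) (auto simp: zero_fun_def cfun.subspace_0[OF subspace_spaceE, unfolded zero_fun_def])

section \<open>The splitting of E along f0, the semigroup T and its generator\<close>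

context
  fixes f0 :: "real \<Rightarrow> complex"
  assumes f0: "f0 \<in> spaceE" and phi_f0: "phi f0 = 1"
begin

lemma spaceF_iff: "f \<in> spaceF f0 \<longleftrightarrow> (\<exists>c. f = c *\<^sub>C f0)"
  by (auto simp: spaceF_def cfun.span_singleton)

lemma projection_in_spaceG: "f \<in> spaceE \<Longrightarrow> f - phi f *\<^sub>C f0 \<in> spaceG"
  by (simp add: spaceG_def spaceE_diff spaceE_scaleC f0 phi_diff phi_scaleC phi_f0)

lemma phi_decomposition: "v \<in> spaceG \<Longrightarrow> phi (c *\<^sub>C f0 + v) = c"
  by (simp add: phi_add phi_scaleC spaceE_scaleC f0 spaceG_D phi_f0)

lemma decomposition_in_spaceE: "v \<in> spaceG \<Longrightarrow> c *\<^sub>C f0 + v \<in> spaceE"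
  by (simp add: spaceE_add spaceE_scaleC f0 spaceG_D)

lemma decompose:
  assumes "f \<in> spaceE"
  obtains c v where "v \<in> spaceG" "f = c *\<^sub>C f0 + v"
  using projection_in_spaceG[OF assms] that[of "f - phi f *\<^sub>C f0" "phi f"] by simp

text \<open>Serves the splittings of both E and D(A): \<open>mem\<close> says that membership in
  \<open>X\<close> depends only on the component in G. The intersection is trivial because
  \<open>phi\<close> recovers the coefficient of \<open>f0\<close>.\<close>

lemma direct_sum_spaceF:
  assumes X: "cfun.subspace X" "X \<subseteq> spaceE" and V: "cfun.subspace V" "V \<subseteq> spaceG"
    and mem: "\<And>c v. v \<in> spaceG \<Longrightarrow> c *\<^sub>C f0 + v \<in> X \<longleftrightarrow> v \<in> V"
  shows "direct_sum X (spaceF f0) V"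
  unfolding direct_sum_def
proof (intro conjI X V)
  show "cfun.subspace (spaceF f0)"
    by (simp add: spaceF_def cfun.subspace_span)
  show "X = spaceF f0 + V"
  proof (intro set_eqI iffI)
    show "f \<in> spaceF f0 + V" if f: "f \<in> X" for f
    proof -
      obtain c v where "v \<in> spaceG" "f = c *\<^sub>C f0 + v"
        using f X(2) decompose by blast
      then show ?thesis
        using f mem by (auto simp: spaceF_iff intro!: set_plus_intro)
    qed
    show "f \<in> X" if "f \<in> spaceF f0 + V" for f
      using that V(2) by (auto simp: spaceF_iff mem subset_iff elim!: set_plus_elim)
  qed
  show "spaceF f0 \<inter> V = {0}"
  proof (intro equalityI subsetI)
    fix f assume "f \<in> spaceF f0 \<inter> V"
    then obtain c where "f = c *\<^sub>C f0" "f \<in> spaceG"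
      using V(2) by (auto simp: spaceF_iff)
    moreover from this have "c = 0"
      using spaceG_D(2)[of f] by (simp add: phi_scaleC phi_f0)
    ultimately show "f \<in> {0}"
      by simp
  qed (auto simp: spaceF_def cfun.span_zero cfun.subspace_0[OF V(1)])
qed

lemma direct_sum_spaceE: "direct_sum spaceE (spaceF f0) spaceG"
  by (rule direct_sum_spaceF) (auto simp: subspace_spaceE subspace_spaceG spaceG_D decomposition_in_spaceE)

text \<open>\<open>phi\<close> reads off the coefficient \<open>c\<close>, so the semigroup is the
  identity on F and translation on G. Later arguments rest on this form.\<close>

lemma semigroupT_decomposition:
  "v \<in> spaceG \<Longrightarrow> semigroupT f0 t (c *\<^sub>C f0 + v) = c *\<^sub>C f0 + left_translation t v"
  unfolding semigroupT_def phi_decomposition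
  by (simp add: scaleC_def left_translation_def fun_eq_iff)

lemma C0_semigroup_T: "C0_semigroup spaceE normE (semigroupT f0)"
  unfolding C0_semigroup_def
proof (intro conjI allI ballI impI)
  note T = semigroupT_decomposition
  show "cfun.subspace spaceE"
    by (rule subspace_spaceE)
  fix f assume "f \<in> spaceE"
  then obtain c v where v: "v \<in> spaceG" and f: "f = c *\<^sub>C f0 + v"
    by (rule decompose)
  show "semigroupT f0 t f \<in> spaceE" for t
    by (simp add: f v T decomposition_in_spaceE spaceG_left_translation)
  show "semigroupT f0 t (f + g) = semigroupT f0 t f + semigroupT f0 t g" if "g \<in> spaceE" for t g
  proof -
    from that obtain d w where w: "w \<in> spaceG" and g: "g = d *\<^sub>C f0 + w"
      by (rule decompose)
    have "f + g = (c + d) *\<^sub>C f0 + (v + w)"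
      by (simp add: f g cfun.scale_left_distrib add_ac)
    then have "semigroupT f0 t (f + g) = (c + d) *\<^sub>C f0 + left_translation t (v + w)"
      using cfun.subspace_add[OF subspace_spaceG v w] by (simp only: T)
    moreover have "semigroupT f0 t f + semigroupT f0 t g =
        (c *\<^sub>C f0 + left_translation t v) + (d *\<^sub>C f0 + left_translation t w)"
      by (simp only: f g T v w)
    ultimately show ?thesis
      by (simp add: left_translation_add cfun.scale_left_distrib add_ac)
  qed
  show "semigroupT f0 t (d *\<^sub>C f) = d *\<^sub>C semigroupT f0 t f" for t d
    using v cfun.subspace_scale[OF subspace_spaceG v, of d]
    by (simp add: f T left_translation_scaleC cfun.scale_right_distrib)
  show "semigroupT f0 0 f = f"
    by (simp add: f v T left_translation_0)
  show "semigroupT f0 (s + t) f = semigroupT f0 s (semigroupT f0 t f)" for s t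
    by (simp add: f v T spaceG_left_translation left_translation_left_translation)
  \<comment> \<open>The component in F is fixed and cancels in the difference, which leaves strong
    continuity of translation.\<close>
  show "((\<lambda>t. normE (semigroupT f0 t f - semigroupT f0 s f)) \<longlongrightarrow> 0) (at s within {0..})" for s
    using left_translation_continuous[of v s "{0..}"] v by (simp add: f T spaceG_D)
next
  fix t
  \<comment> \<open>The projection onto F has norm at most \<open>normE f0\<close>. It enters twice,
    in \<open>semigroupT f0 t f\<close> and in \<open>v\<close>, which gives the factor 2.\<close>
  have "normE (semigroupT f0 t f) \<le> (1 + 2 * normE f0) * normE f" if f: "f \<in> spaceE" for f
  proof -
    define v where "v = f - phi f *\<^sub>C f0"
    have v: "v \<in> spaceG" and f_eq: "f = phi f *\<^sub>C f0 + v"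
      using f by (simp_all add: v_def projection_in_spaceG)
    have P: "normE (phi f *\<^sub>C f0) \<le> normE f * normE f0"
      using norm_phi_le[of f] by (intro order_trans[OF normE_scaleC] mult_right_mono f0 normE_nonneg)
    have "normE (semigroupT f0 t f) \<le> normE (phi f *\<^sub>C f0) + normE (left_translation t v)"
      by (subst f_eq, subst semigroupT_decomposition[OF v])
        (intro normE_add spaceE_scaleC spaceE_left_translation f0 spaceG_D(1)[OF v])
    moreover have "normE (left_translation t v) \<le> normE v"
      by (intro normE_left_translation spaceG_D v)
    moreover have "normE v \<le> normE f + normE (phi f *\<^sub>C f0)"
      unfolding v_def by (intro normE_diff spaceE_scaleC f f0)
    ultimately show ?thesis
      using P by (simp add: algebra_simps)
  qed
  then show "\<exists>C. \<forall>f\<in>spaceE. normE (semigroupT f0 t f) \<le> C * normE f"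
    by blast
qed

text \<open>The component in F is fixed by the semigroup and cancels in the difference
  quotient.\<close>

lemma has_generator_value_T:
  "v \<in> spaceG \<Longrightarrow> has_generator_value normE (semigroupT f0) (c *\<^sub>C f0 + v) g \<longleftrightarrow>
    has_generator_value normE left_translation v g"
  by (simp add: has_generator_value_def semigroupT_decomposition)

text \<open>The limit for \<open>semigroupT\<close> is sought in \<open>spaceE\<close>, the one for
  translation in \<open>spaceG\<close>; \<open>domB_iff\<close> shows that the two conditions
  agree.\<close>

lemma decomposition_in_domA_iff: "v \<in> spaceG \<Longrightarrow> c *\<^sub>C f0 + v \<in> domA f0 \<longleftrightarrow> v \<in> domB"
  unfolding domA_def generator_domain_def domB_iff
  by (auto simp: has_generator_value_T has_generator_value_left_translation_iff decomposition_in_spaceE spaceG_D)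

lemma domA_decompose:
  assumes "f \<in> domA f0"
  obtains c v where "v \<in> domB" "f = c *\<^sub>C f0 + v"
proof -
  have "f \<in> spaceE"
    using assms by (simp add: domA_def generator_domain_def)
  then obtain c v where "v \<in> spaceG" "f = c *\<^sub>C f0 + v"
    by (rule decompose)
  then show thesis
    using assms that decomposition_in_domA_iff by blast
qed

lemma opA_decomposition: "v \<in> domB \<Longrightarrow> opA f0 (c *\<^sub>C f0 + v) = opB v"
proof -
  assume v: "v \<in> domB"
  have "opA f0 (c *\<^sub>C f0 + v) = generator spaceE normE left_translation v"
    by (simp add: opA_def generator_def has_generator_value_T domB_D v)
  also have "\<dots> = opB v"
    by (intro generator_left_translation_eq) (auto intro: domB_D spaceG_D v)
  finally show ?thesis .
qed

lemma domA_I: "v \<in> domB \<Longrightarrow> c *\<^sub>C f0 + v \<in> domA f0"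
  by (simp add: decomposition_in_domA_iff domB_D)

lemma subspace_domA: "cfun.subspace (domA f0)"
proof (rule cfun.subspaceI)
  have "0 *\<^sub>C f0 + 0 \<in> domA f0"
    by (intro domA_I cfun.subspace_0 subspace_domB)
  then show "0 \<in> domA f0" by simp
  fix f assume "f \<in> domA f0"
  then obtain c v where v: "v \<in> domB" "f = c *\<^sub>C f0 + v"
    by (rule domA_decompose)
  show "f + g \<in> domA f0" if "g \<in> domA f0" for g
  proof -
    from that obtain d w where w: "w \<in> domB" "g = d *\<^sub>C f0 + w"
      by (rule domA_decompose)
    have "(c + d) *\<^sub>C f0 + (v + w) \<in> domA f0"
      by (intro domA_I cfun.subspace_add subspace_domB v w)
    then show ?thesis
      by (simp add: v w cfun.scale_left_distrib add_ac)
  qed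
  show "d *\<^sub>C f \<in> domA f0" for d
    using domA_I[OF cfun.subspace_scale[OF subspace_domB v(1), of d], of "d * c"]
    by (simp add: v cfun.scale_right_distrib)
qed

lemma direct_sum_domA: "direct_sum (domA f0) (spaceF f0) domB"
proof (rule direct_sum_spaceF)
  show "domA f0 \<subseteq> spaceE"
    by (auto simp: domA_def generator_domain_def)
qed (auto simp: subspace_domA subspace_domB decomposition_in_domA_iff domB_D)

lemma operator_direct_sum_A: "operator_direct_sum (domA f0) (opA f0) (spaceF f0) (\<lambda>_. 0) domB opB"
  unfolding operator_direct_sum_def
  by (auto simp: direct_sum_domA spaceF_iff opA_decomposition)

section \<open>The eigenvalue 0\<close>

lemma f0_in_domA: "f0 \<in> domA f0" and opA_f0: "opA f0 f0 = 0"
proof -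
  have 0: "0 \<in> domB" by (rule cfun.subspace_0[OF subspace_domB])
  show "f0 \<in> domA f0" using domA_I[OF 0, of 1] by simp
  show "opA f0 f0 = 0" using opA_decomposition[OF 0, of 1] by (simp add: opB_0)
qed

lemma f0_neq_0: "f0 \<noteq> 0"
  using phi_f0 by (auto simp: phi_def zero_fun_def)

text \<open>The operator sends \<open>c f0 + v\<close> to the derivative of \<open>v\<close>. Where
  this vanishes, \<open>v\<close> is a constant in E, hence zero.\<close>

lemma eigenspace_0: "eigenspace (domA f0) (opA f0) 0 = cfun.span {f0}"
proof (intro equalityI subsetI)
  fix f assume "f \<in> eigenspace (domA f0) (opA f0) 0"
  then have f: "f \<in> domA f0" "opA f0 f = 0"
    by (auto simp: eigenspace_def)
  then obtain c v where v: "v \<in> domB" "f = c *\<^sub>C f0 + v"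
    using domA_decompose by blast
  then have "opB v = 0"
    using f opA_decomposition by simp
  then have "v = 0"
    using domB_D[OF v(1)] by (intro eigenfunction_eq_0[where z = 0]) (auto simp: spaceG_D zero_fun_def)
  then show "f \<in> cfun.span {f0}"
    using v by (auto simp: cfun.span_singleton)
next
  fix f assume "f \<in> cfun.span {f0}"
  then obtain c where f: "f = c *\<^sub>C f0 + 0"
    by (auto simp: cfun.span_singleton)
  have 0: "0 \<in> domB"
    by (rule cfun.subspace_0[OF subspace_domB])
  have "f \<in> domA f0" "opA f0 f = 0"
    using domA_I[OF 0, of c] opA_decomposition[OF 0, of c] by (simp_all only: f opB_0)
  then show "f \<in> eigenspace (domA f0) (opA f0) 0"
    by (simp add: eigenspace_def)
qed

lemma eigenvalue_0: "eigenvalue (domA f0) (opA f0) 0"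
  unfolding eigenvalue_def using f0_in_domA opA_f0 f0_neq_0 by auto

section \<open>Resolvent set and spectrum\<close>

lemma resolvent_equation:
  assumes "v \<in> domB"
  shows "z *\<^sub>C (c *\<^sub>C f0 + v) - opA f0 (c *\<^sub>C f0 + v) = (z * c) *\<^sub>C f0 + (z *\<^sub>C v - opB v)"
    and "z *\<^sub>C v - opB v \<in> spaceG"
proof -
  show "z *\<^sub>C (c *\<^sub>C f0 + v) - opA f0 (c *\<^sub>C f0 + v) = (z * c) *\<^sub>C f0 + (z *\<^sub>C v - opB v)"
    by (simp add: opA_decomposition assms cfun.scale_right_distrib)
  show "z *\<^sub>C v - opB v \<in> spaceG"
    by (intro cfun.subspace_diff[OF subspace_spaceG] cfun.subspace_scale[OF subspace_spaceG] domB_D assms)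
qed

text \<open>By \<open>resolvent_equation\<close>, \<open>z - A\<close> is diagonal in the splitting:
  multiplication by the nonzero number \<open>z\<close> on F, and \<open>z - d/dx\<close> on G,
  which \<open>resolvent_Re_nonzero\<close> inverts.\<close>

lemma Re_nonzero_in_resolvent_set:
  assumes z: "Re z \<noteq> 0"
  shows "z \<in> resolvent_set spaceE normE (domA f0) (opA f0)"
proof -
  let ?R = "\<lambda>f. z *\<^sub>C f - opA f0 f"
  have z0: "z \<noteq> 0" using z by auto
  have maps: "?R f \<in> spaceE" if "f \<in> domA f0" for f
    using that by (auto elim!: domA_decompose simp: resolvent_equation decomposition_in_spaceE)
  have inj: "inj_on ?R (domA f0)"
  proof (rule inj_onI)
    fix f g assume "f \<in> domA f0" "g \<in> domA f0" and eq: "?R f = ?R g"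
    then obtain c v d w where f: "v \<in> domB" "f = c *\<^sub>C f0 + v" and g: "w \<in> domB" "g = d *\<^sub>C f0 + w"
      using domA_decompose by metis
    have "(z * c) *\<^sub>C f0 + (z *\<^sub>C v - opB v) = (z * d) *\<^sub>C f0 + (z *\<^sub>C w - opB w)"
      using eq f g by (simp only: resolvent_equation)
    \<comment> \<open>Applying \<open>phi\<close> compares the coefficients of \<open>f0\<close>,
      because the remaining terms lie in G.\<close>
    moreover from arg_cong[OF this, of phi] have cd: "c = d"
      using z0 by (simp add: phi_decomposition resolvent_equation f g)
    ultimately have eq': "z *\<^sub>C v - opB v = z *\<^sub>C w - opB w"
      by simp
    have "v - w = 0"
    proof (rule eigenfunction_eq_0)
      show "v - w \<in> spaceE"
        by (intro spaceE_diff spaceG_D domB_D f g)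
      have "z * (v - w) x = opB v x - opB w x" for x
        using fun_cong[OF eq', of x] by (simp add: scaleC_def algebra_simps)
      then show "((v - w) has_vector_derivative z * (v - w) x) (at x)" for x
        using has_vector_derivative_diff[OF domB_D(3)[OF f(1)] domB_D(3)[OF g(1)], of x]
        by (simp add: fun_diff_def)
    qed
    then show "f = g"
      using f g cd by simp
  qed
  \<comment> \<open>The first summand bounds the component \<open>(c / z) f0\<close>. In the second,
    \<open>1 + normE f0\<close> bounds the projection onto G, and the division by the modulus of
    \<open>Re z\<close> comes from the resolvent there.\<close>
  define C where "C = normE f0 / norm z + (1 + normE f0) / \<bar>Re z\<bar>"
  have solve: "\<exists>f\<in>domA f0. ?R f = h \<and> normE f \<le> C * normE h" if h: "h \<in> spaceE" for h
  proof -
    define c where "c = phi h"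
    define g where "g = h - c *\<^sub>C f0"
    have g: "g \<in> spaceG" and h_eq: "h = c *\<^sub>C f0 + g"
      using h by (simp_all add: g_def c_def projection_in_spaceG)
    obtain v where v: "v \<in> spaceE" "\<And>x. (v has_vector_derivative z * v x - g x) (at x)"
      "normE v \<le> normE g / \<bar>Re z\<bar>"
      using resolvent_Re_nonzero[OF z spaceG_D(1)[OF g]] by blast
    have v': "(v has_vector_derivative (z *\<^sub>C v - g) x) (at x)" for x
      using v(2) by (simp add: scaleC_def)
    have E: "z *\<^sub>C v - g \<in> spaceE"
      by (intro spaceE_diff spaceE_scaleC v spaceG_D g)
    have "phi (z *\<^sub>C v - g) = 0"
      by (rule phi_derivative_eq_0[OF v(1) E v'])
    \<comment> \<open>Both \<open>phi g\<close> and \<open>phi\<close> of the derivative vanish,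
      hence so does \<open>z * phi v\<close>, and \<open>z\<close> is nonzero.\<close>
    then have "v \<in> spaceG"
      using z0 v(1) g by (simp add: spaceG_def phi_diff phi_scaleC spaceE_scaleC)
    then have dom: "v \<in> domB"
      unfolding domB_iff using E v' by blast
    have op: "opB v = z *\<^sub>C v - g"
      by (rule opB_eq[OF v(1) E v'])
    have c: "norm c \<le> normE h"
      unfolding c_def by (rule norm_phi_le)
    have "normE g \<le> normE h + normE (c *\<^sub>C f0)"
      unfolding g_def by (intro normE_diff h spaceE_scaleC f0)
    moreover have "normE (c *\<^sub>C f0) \<le> normE h * normE f0"
      using c by (intro order_trans[OF normE_scaleC] mult_right_mono f0 normE_nonneg)
    ultimately have "normE g \<le> normE h + normE h * normE f0"
      by linarith
    then have "normE g / \<bar>Re z\<bar> \<le> (normE h + normE h * normE f0) / \<bar>Re z\<bar>"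
      by (rule divide_right_mono[OF _ abs_ge_zero])
    moreover have "normE ((c / z) *\<^sub>C f0 + v) \<le> normE ((c / z) *\<^sub>C f0) + normE v"
      by (intro normE_add spaceE_scaleC f0 v)
    moreover have "normE ((c / z) *\<^sub>C f0) \<le> (normE h / norm z) * normE f0"
      using c by (intro order_trans[OF normE_scaleC] mult_right_mono f0 normE_nonneg)
        (simp add: norm_divide divide_right_mono)
    ultimately have "normE ((c / z) *\<^sub>C f0 + v) \<le> C * normE h"
      using v(3) by (simp add: C_def algebra_simps add_divide_distrib)
    moreover have "?R ((c / z) *\<^sub>C f0 + v) = h"
      using z0 by (simp add: resolvent_equation[OF dom] op h_eq)
    ultimately show ?thesis
      using domA_I[OF dom] by blast
  qed
  have "?R ` domA f0 = spaceE"
    using maps solve by (fastforce simp: image_iff)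
  \<comment> \<open>\<open>solve\<close> bounds some preimage of \<open>?R f\<close>; injectivity
    identifies it with \<open>f\<close>.\<close>
  moreover have "normE f \<le> C * normE (?R f)" if "f \<in> domA f0" for f
    using solve[OF maps[OF that]] inj_onD[OF inj _ _ that] by metis
  ultimately show ?thesis
    using inj by (auto simp: resolvent_set_def bij_betw_def)
qed

text \<open>The exponential factor is unimodular on the real line. Multiplication by it builds the
  right-hand side without solution, and the integrating factor, for imaginary
  \<open>z\<close>.\<close>

lemma spaceE_exp_mult:
  assumes "Re z = 0" "f \<in> spaceE"
  shows "(\<lambda>x. exp (z * of_real x) * f x) \<in> spaceE"
proof -
  note [measurable] = spaceE_D(4)[OF assms(2)]
  have norm: "norm (exp (z * of_real x) * f x) = norm (f x)" for x
    using assms(1) by (simp add: norm_mult)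
  have "integrable lborel (\<lambda>x. exp (z * of_real x) * f x)"
    by (rule Bochner_Integration.integrable_bound[OF spaceE_D(1)[OF assms(2)]]) (auto simp: norm)
  moreover have "((\<lambda>x. exp (z * of_real x) * f x) \<longlongrightarrow> 0) at_infinity"
    by (rule tendsto_norm_zero_cancel) (use spaceE_D(3)[OF assms(2)] in \<open>simp only: norm tendsto_norm_zero\<close>)
  moreover have "continuous_on UNIV (\<lambda>x. exp (z * of_real x) * f x)"
    by (intro continuous_intros spaceE_D assms)
  ultimately show ?thesis
    by (simp add: spaceE_def)
qed

lemma imaginary_not_in_resolvent_set:
  assumes z: "Re z = 0"
  shows "z \<notin> resolvent_set spaceE normE (domA f0) (opA f0)"
proof
  assume "z \<in> resolvent_set spaceE normE (domA f0) (opA f0)"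
  then have bij: "bij_betw (\<lambda>f. z *\<^sub>C f - opA f0 f) (domA f0) spaceE"
    by (simp add: resolvent_set_def)
  show False
  proof (cases "z = 0")
    case True
    \<comment> \<open>At 0 injectivity fails: \<open>f0\<close> and its double have the same image
      0.\<close>
    have "2 *\<^sub>C f0 \<in> eigenspace (domA f0) (opA f0) 0"
      unfolding eigenspace_0 by (intro cfun.span_scale cfun.span_base) simp
    then have "2 *\<^sub>C f0 = f0"
      using inj_onD[OF bij_betw_imp_inj_on[OF bij], of "2 *\<^sub>C f0" f0] True f0_in_domA opA_f0
      by (simp add: eigenspace_def)
    then have "phi (2 *\<^sub>C f0) = phi f0" by simp
    then show False
      by (simp add: phi_scaleC phi_f0)
  next
    case False
    txt \<open>
      Solvability of \<open>z f - f' = g\<close> forces the Fourier coefficient of \<open>g\<close> at \<open>z\<close> to vanish.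
      For this \<open>g\<close> it equals 2, because the shift by \<open>\<pi> / Im z\<close> changes the sign of \<open>exp (z x)\<close>.
    \<close>
    define a where "a = pi / Im z"
    define h where "h x = exp (z * of_real x) * f0 x" for x :: real
    define g where "g = h - left_translation a h"
    have h: "h \<in> spaceE"
      unfolding h_def[abs_def] by (rule spaceE_exp_mult[OF z f0])
    have g: "g \<in> spaceG"
      by (simp add: g_def spaceG_def spaceE_diff spaceE_left_translation h phi_diff phi_left_translation)
    have "z * of_real a = \<i> * of_real pi"
      using z False by (auto simp: complex_eq_iff a_def)
    then have "exp (z * of_real (x + a)) = - exp (z * of_real x)" for x :: real
      by (simp add: distrib_left exp_add)
    then have g_eq: "exp (- z * of_real x) * g x = (f0 + left_translation a f0) x" for x
      by (simp add: g_def h_def left_translation_def algebra_simps exp_minus)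
    obtain f where "f \<in> domA f0" "z *\<^sub>C f - opA f0 f = g"
      using bij_betw_imp_surj_on[OF bij] spaceG_D(1)[OF g] by (metis (no_types, lifting) imageE)
    then obtain c v where v: "v \<in> domB" and eq: "(z * c) *\<^sub>C f0 + (z *\<^sub>C v - opB v) = g"
      using domA_decompose resolvent_equation(1) by metis
    \<comment> \<open>The right-hand side has integral zero, so the component in F vanishes and only
      the equation in G remains.\<close>
    have "z * c = 0"
      using arg_cong[OF eq, of phi] spaceG_D(2)[OF g] by (simp add: phi_decomposition resolvent_equation v)
    then have "z *\<^sub>C v - opB v = g"
      using eq by (simp only: cfun.scale_zero_left add_0)
    then have op: "opB v x = z * v x - g x" for x
      by (auto simp: scaleC_def)
    \<comment> \<open>Integrating factor: the derivative of \<open>u\<close> is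
      \<open>- exp (- z x) g x\<close>. Since \<open>u\<close> vanishes at infinity, the Fourier
      coefficient of \<open>g\<close> must be 0.\<close>
    define u where "u x = exp (- z * of_real x) * v x" for x :: real
    have "(LINT x|lborel. - (f0 + left_translation a f0) x) = 0"
    proof (rule integral_derivative_eq_0)
      show "(u has_vector_derivative - (f0 + left_translation a f0) x) (at x)" for x
        using has_vector_derivative_mult[OF exp_mult_has_vector_derivative[of "- z" x] domB_D(3)[OF v, of x]]
        unfolding u_def[abs_def] g_eq[symmetric] op by (simp add: algebra_simps)
      have "u \<in> spaceE"
        unfolding u_def[abs_def] using z by (intro spaceE_exp_mult spaceG_D domB_D v) simp
      then show "(u \<longlongrightarrow> 0) at_infinity" by (rule spaceE_D)
      have "f0 + left_translation a f0 \<in> spaceE"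
        by (intro spaceE_add spaceE_left_translation f0)
      then show "continuous_on UNIV (\<lambda>x. - (f0 + left_translation a f0) x)"
        "integrable lborel (\<lambda>x. - (f0 + left_translation a f0) x)"
        using spaceE_D by (blast intro: continuous_on_minus Bochner_Integration.integrable_minus)+
    qed
    then have "phi (f0 + left_translation a f0) = 0"
      by (simp add: phi_def del: plus_fun_apply)
    then show False
      by (simp add: phi_add f0 spaceE_left_translation phi_left_translation phi_f0)
  qed
qed

lemma spectrum_A: "spectrum spaceE normE (domA f0) (opA f0) = range (\<lambda>s::real. \<i> * complex_of_real s)"
proof -
  have "Re z = 0 \<longleftrightarrow> z \<in> range (\<lambda>s::real. \<i> * complex_of_real s)" for z
    by (auto simp: complex_eq_iff image_iff)
  then show ?thesis
    using Re_nonzero_in_resolvent_set imaginary_not_in_resolvent_set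
    unfolding spectrum_def by blast
qed

end

theorem proposition2p2:
  fixes f0 :: "real \<Rightarrow> complex"
  assumes "f0 \<in> spaceE"
    and "\<And>x. f0 x \<in> \<real> \<and> 0 < Re (f0 x) \<and> Re (f0 x) \<le> 1"
    and "(LINT x|lborel. f0 x) = 1"
  shows "direct_sum spaceE (spaceF f0) spaceG
    \<and> C0_semigroup spaceE normE (semigroupT f0)
    \<and> C0_semigroup spaceG normE left_translation
    \<and> operator_direct_sum (domA f0) (opA f0) (spaceF f0) (\<lambda>_. 0) domB opB
    \<and> domB = {f \<in> spaceG. (\<forall>x. f differentiable (at x)) \<and> ddx f \<in> spaceG}
    \<and> (\<forall>f\<in>domB. opB f = ddx f)
    \<and> spectrum spaceE normE (domA f0) (opA f0) = range (\<lambda>s::real. \<i> * complex_of_real s)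
    \<and> eigenvalue (domA f0) (opA f0) 0
    \<and> eigenspace (domA f0) (opA f0) 0 = cfun.span {f0}
    \<and> cfun.dim (eigenspace (domA f0) (opA f0) 0) = 1"
proof -
  have phi_f0: "phi f0 = 1"
    using assms(3) by (simp add: phi_def)
  note f0 = assms(1) phi_f0
  have "cfun.dim (cfun.span {f0}) = 1"
    using cfun.dim_span_eq_card_independent[of "{f0}"] f0_neq_0[OF f0] by simp
  then show ?thesis
    using direct_sum_spaceE[OF f0] C0_semigroup_T[OF f0] operator_direct_sum_A[OF f0]
      spectrum_A[OF f0] eigenvalue_0[OF f0] eigenspace_0[OF f0]
    by (simp add: C0_semigroup_left_translation domB_eq[symmetric] opB_eq_ddx)
qed

end
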